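(* Let $R$ be a supertropical domain, let $A\in M_n(R)$ be quasi-invertible (i.e. $|A|$ is invertible in $R$), let $v\in R^{(n)}$, and let $x\in R^{(n)}$ be a tangible vector with $Ax\models_{gs}v$. Then $x\le_\nu\widehat{(A^{\nabla}v)}$.
   Context: A semiring with ghosts is a triple $(R,\mathcal G_0,\nu)$ where $R$ is a semiring with zero $0_R$ and unit $1_R$, $\mathcal G_0=\mathcal G\cup\{0_R\}$ is a semiring ideal (the ghost ideal, whose elements are called ghost), and $\nu:R\to\mathcal G_0$, $\nu(a)=a+a$ (written $a^\nu$), is an idempotent semiring homomorphism. It is a supertropical semiring if $a+b=a^\nu$ whenever $a^\nu=b^\nu$, and $a+b\in\{a,b\}$ whenever $a^\nu\ne b^\nu$ (equivalently, $\mathcal G_0$ is totally ordered via $a^\nu\le b^\nu$ iff $a^\nu+b^\nu=b^\nu$). A supertropical domain is a commutative supertropical semiring such that $\mathcal T=R\setminus\mathcal G_0$ (the tangible elements) is a monoid under multiplication and $\nu|_{\mathcal T}:\mathcal T\to\mathcal G$ is onto. Put $\mathcal T_0=\mathcal T\cup\{0_R\}$. Write $a\le_\nu b$ if $a^\nu\le b^\nu$, and $b\models_{gs}a$ ("ghost surpasses") if $b=a+c$ for some $c\in\mathcal G_0$. For vectors in $R^{(n)}$ (the $n$-fold Cartesian product) both relations are taken componentwise. A nonzero vector is tangible if all its components lie in $\mathcal T_0$. A tangible retract function is fixed: a map $\hat\nu:R\to\mathcal T_0$, written $b\mapsto\hat b$, which is the identity on $\mathcal T_0$ and satisfies $(\hat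 b)^\nu=b$ for all $b\in\mathcal G_0$; it is applied componentwise to vectors. For $A=(a_{i,j})\in M_n(R)$, $|A|=\sum_{\sigma\in S_n}a_{1,\sigma(1)}\cdots a_{n,\sigma(n)}$ (the permanent), $A_{i,j}$ is obtained by deleting row $i$ and column $j$, and $\operatorname{adj}(A)$ has $(i,j)$ entry $|A_{j,i}|$ (the empty determinant is $1_R$). If $|A|$ is invertible, $A^{\nabla}=|A|^{-1}\operatorname{adj}(A)$. *)

theory Defs
  imports "Jordan_Normal_Form.Determinant"
begin

section \<open>Supertropical domains\<close>

definition ghost_map :: "'a::semiring_1 \<Rightarrow> 'a"  (\<open>\<nu>\<close>) where
  "\<nu> a = a + a"

text \<open>The parameter \<open>G\<close> is the set of ghosts and \<open>insert 0 G\<close> is the ghost ideal.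
  Since 0 and 1 are distinct in class \<^class>\<open>semiring_1\<close>, the zero ring is not covered; it is never
  a supertropical domain, because there 1 is tangible and hence not in the ghost ideal.
  As \<open>insert 0 G\<close> need not contain 1, no condition on \<open>\<nu> 1\<close> is imposed; multiplicativity already
  makes it a unit for the image of \<open>\<nu>\<close>.\<close>

locale semiring_with_ghosts =
  fixes G :: "'a::semiring_1 set"
  assumes ghost_add: "a \<in> insert 0 G \<Longrightarrow> b \<in> insert 0 G \<Longrightarrow> a + b \<in> insert 0 G"
    and ghost_mult_left: "a \<in> insert 0 G \<Longrightarrow> r * a \<in> insert 0 G"
    and ghost_mult_right: "a \<in> insert 0 G \<Longrightarrow> a * r \<in> insert 0 G"
    and nu_ghost: "\<nu> (a::'a) \<in> insert 0 G"
    and nu_zero: "\<nu> (0::'a) = 0"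
    and nu_add: "\<nu> (a + b :: 'a) = \<nu> a + \<nu> b"
    and nu_mult: "\<nu> (a * b :: 'a) = \<nu> a * \<nu> b"
    and nu_idem: "\<nu> (\<nu> a) = \<nu> (a::'a)"

locale supertropical_semiring = semiring_with_ghosts G
  for G :: "'a::semiring_1 set" +
  assumes add_nu_eq: "\<nu> (a::'a) = \<nu> b \<Longrightarrow> a + b = \<nu> a"
    and add_nu_neq: "\<nu> (a::'a) \<noteq> \<nu> b \<Longrightarrow> a + b \<in> {a, b}"

definition tangibles :: "'a::semiring_1 set \<Rightarrow> 'a set" where
  "tangibles G = UNIV - insert 0 G"

locale supertropical_domain = supertropical_semiring G
  for G :: "'a::comm_semiring_1 set" +
  assumes tangible_one: "1 \<in> tangibles G"
    and tangible_mult: "a \<in> tangibles G \<Longrightarrow> b \<in> tangibles G \<Longrightarrow> a * b \<in> tangibles G"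
    and nu_onto: "\<nu> ` tangibles G = G"

definition tangible_retract :: "'a::semiring_1 set \<Rightarrow> ('a \<Rightarrow> 'a) \<Rightarrow> bool" where
  "tangible_retract G h \<longleftrightarrow>
     (\<forall>b. h b \<in> insert 0 (tangibles G)) \<and>
     (\<forall>b \<in> insert 0 (tangibles G). h b = b) \<and>
     (\<forall>b \<in> insert 0 G. \<nu> (h b) = b)"

section \<open>Relations on elements and vectors\<close>

text \<open>For ghosts \<open>p\<close>, \<open>q\<close> the order is given by \<open>p \<le> q\<close> iff \<open>p + q = q\<close>.\<close>

definition le_nu :: "'a::semiring_1 \<Rightarrow> 'a \<Rightarrow> bool" where
  "le_nu a b \<longleftrightarrow> \<nu> a + \<nu> b = \<nu> b"

text \<open>\<open>ghost_surpasses G b a\<close> means that \<open>b\<close> ghost surpasses \<open>a\<close>.\<close>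

definition ghost_surpasses :: "'a::semiring_1 set \<Rightarrow> 'a \<Rightarrow> 'a \<Rightarrow> bool" where
  "ghost_surpasses G b a \<longleftrightarrow> (\<exists>c \<in> insert 0 G. b = a + c)"

definition le_nu_vec :: "'a::semiring_1 vec \<Rightarrow> 'a vec \<Rightarrow> bool" where
  "le_nu_vec x y \<longleftrightarrow> dim_vec x = dim_vec y \<and> (\<forall>i < dim_vec x. le_nu (x $ i) (y $ i))"

definition ghost_surpasses_vec :: "'a::semiring_1 set \<Rightarrow> 'a vec \<Rightarrow> 'a vec \<Rightarrow> bool" where
  "ghost_surpasses_vec G x y \<longleftrightarrow>
     dim_vec x = dim_vec y \<and> (\<forall>i < dim_vec x. ghost_surpasses G (x $ i) (y $ i))"

definition tangible_vec :: "'a::semiring_1 set \<Rightarrow> 'a vec \<Rightarrow> bool" where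
  "tangible_vec G x \<longleftrightarrow>
     x \<noteq> 0\<^sub>v (dim_vec x) \<and> (\<forall>i < dim_vec x. x $ i \<in> insert 0 (tangibles G))"

section \<open>Supertropical determinant and quasi-inverse\<close>

text \<open>Intended for square matrices; the permanent of a 0 by 0 matrix is 1.\<close>

definition permanent :: "'a::comm_semiring_1 mat \<Rightarrow> 'a" where
  "permanent A =
     (\<Sum>p \<in> {p. p permutes {0..<dim_row A}}. \<Prod>i = 0..<dim_row A. A $$ (i, p i))"

definition perm_adj :: "'a::comm_semiring_1 mat \<Rightarrow> 'a mat" where
  "perm_adj A = mat (dim_row A) (dim_col A) (\<lambda>(i, j). permanent (mat_delete A j i))"

definition quasi_invertible :: "'a::comm_semiring_1 mat \<Rightarrow> bool" where
  "quasi_invertible A \<longleftrightarrow> square_mat A \<and> (\<exists>b. permanent A * b = 1)"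

text \<open>The description is meaningful only for invertible \<open>a\<close>, whose inverse is then unique.\<close>

definition mult_inverse :: "'a::comm_semiring_1 \<Rightarrow> 'a" where
  "mult_inverse a = (THE b. a * b = 1)"

definition quasi_inverse :: "'a::comm_semiring_1 mat \<Rightarrow> 'a mat" where
  "quasi_inverse A = mult_inverse (permanent A) \<cdot>\<^sub>m perm_adj A"

end

theory Submission
  imports Defs
begin

text \<open>
  The inequality says that Cramer's rule is an upper bound for the tangible solutions of
  \<open>A x \<Turnstile> v\<close>, and it follows from its fraction-free form \<open>|A| x\<^sub>i \<le>\<^sub>\<nu> (adj(A) v)\<^sub>i\<close>, which holds as soon
  as \<open>|A|\<close> is tangible (\<open>tangible_cramer_bound\<close>).

  A sum can be tangible only if it has a unique \<open>\<nu>\<close>-maximal term and that term is tangible. Applied to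
  the permanent this gives a permutation \<open>\<pi>\<close> whose weight is \<open>|A|\<close> and strictly exceeds every other
  weight; thus \<open>\<pi>\<close> plays the role of the diagonal. Applied to row \<open>r\<close> of \<open>A x \<Turnstile> v\<close> it gives an
  alternative: either \<open>a\<^sub>r\<^sub>,\<^sub>\<pi>\<^sub>r x\<^sub>\<pi>\<^sub>r \<le>\<^sub>\<nu> v\<^sub>r\<close>, or \<open>a\<^sub>r\<^sub>,\<^sub>\<pi>\<^sub>r x\<^sub>\<pi>\<^sub>r\<close> is \<open>\<nu>\<close>-dominated by another
  term \<open>a\<^sub>r\<^sub>,\<^sub>c x\<^sub>c\<close> of the same row. Call the row bounded in the first case; in the second, go from row
  \<open>r\<close> to the row \<open>\<pi>\<^sup>-\<^sup>1 c\<close>. From a bounded row go to the row \<open>\<pi>\<^sup>-\<^sup>1 i\<close>, where \<open>i\<close> is the given component.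

  This self-map of the rows permutes some nonempty set \<open>C\<close> of rows. Multiply the inequalities of the
  rows in \<open>C\<close>; almost all factors \<open>x\<^sub>c\<close> occur on both sides and can be cancelled. If no row in \<open>C\<close> is
  bounded, what remains says that a permutation other than \<open>\<pi>\<close> has at least the weight of \<open>\<pi>\<close>, which
  is impossible. Otherwise exactly one row \<open>k\<close> in \<open>C\<close> is bounded, and what remains is
  \<open>|A| x\<^sub>i \<le>\<^sub>\<nu> w v\<^sub>k\<close>, where \<open>w\<close> is one of the terms of the minor \<open>|A\<^sub>k\<^sub>,\<^sub>i|\<close>.

  No cancellation law is assumed in a supertropical domain, but distributivity supplies the one that
  the argument needs (\<open>le_nu_cancel\<close>).
\<close>

section \<open>The order up to \<open>\<nu>\<close>\<close>

context supertropical_domain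
begin

lemma le_nu_refl: "le_nu (a::'a) a"
  using nu_idem[of a] by (simp add: le_nu_def ghost_map_def)

lemma le_nu_trans: "le_nu (a::'a) b \<Longrightarrow> le_nu b c \<Longrightarrow> le_nu a c"
  unfolding le_nu_def by (metis add.assoc)

lemma zero_le_nu: "le_nu 0 (a::'a)"
  by (simp add: le_nu_def nu_zero)

lemma le_nu_add: "le_nu (a::'a) (a + b)"
  using le_nu_refl[of a] by (simp add: le_nu_def nu_add add.assoc[symmetric])

lemma le_nu_sum:
  assumes "finite S" "s \<in> S"
  shows "le_nu (f s :: 'a) (sum f S)"
  unfolding sum.remove[OF assms] by (rule le_nu_add)

lemma le_nu_mult:
  assumes "le_nu (a::'a) b" "le_nu c d"
  shows "le_nu (a * c) (b * d)"
proof -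
  have "le_nu (a * c) (b * c)"
    using assms(1) by (simp add: le_nu_def nu_mult distrib_right[symmetric])
  moreover have "le_nu (b * c) (b * d)"
    using assms(2) by (simp add: le_nu_def nu_mult distrib_left[symmetric])
  ultimately show ?thesis by (rule le_nu_trans)
qed

lemma le_nu_prod:
  assumes "\<And>s. s \<in> S \<Longrightarrow> le_nu (f s :: 'a) (g s)"
  shows "le_nu (prod f S) (prod g S)"
  using assms by (induction S rule: infinite_finite_induct) (auto simp: le_nu_refl le_nu_mult)

lemma not_le_nu_add:
  assumes "\<not> le_nu (a::'a) b"
  shows "a + b = a"
proof -
  have "\<nu> a \<noteq> \<nu> b" using assms le_nu_refl[of b] by (auto simp: le_nu_def)
  then have "a + b \<in> {a, b}" by (rule add_nu_neq)
  moreover have "a + b \<noteq> b" using assms nu_add[of a b] by (auto simp: le_nu_def)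
  ultimately show ?thesis by blast
qed

lemma not_le_nu_sum:
  assumes "finite S" "\<And>s. s \<in> S \<Longrightarrow> \<not> le_nu (a::'a) (f s)"
  shows "a + sum f S = a"
  using assms
proof (induction S rule: finite_induct)
  case (insert s S)
  then have "a + f s = a" by (simp add: not_le_nu_add)
  then show ?case using insert by (simp add: add.assoc[symmetric])
qed simp


section \<open>Tangible sums and products\<close>

lemma nu_not_tangible: "\<nu> (a::'a) \<notin> tangibles G"
  using nu_ghost[of a] by (simp add: tangibles_def)

lemma tangible_factor:
  assumes "a * b \<in> tangibles G"
  shows "a \<in> tangibles G" "b \<in> tangibles G"
  using assms ghost_mult_left[of b a] ghost_mult_right[of a b] unfolding tangibles_def by blast+

lemma tangible_prod:
  assumes "\<And>s. s \<in> S \<Longrightarrow> f s \<in> tangibles G"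
  shows "prod f S \<in> tangibles G"
  using assms
  by (induction S rule: infinite_finite_induct) (auto simp: tangible_one tangible_mult)

lemma tangible_prod_factor:
  assumes "finite S" "s \<in> S" "prod f S \<in> tangibles G"
  shows "f s \<in> tangibles G"
  using assms(3) unfolding prod.remove[OF assms(1,2)] by (rule tangible_factor(1))

lemma tangible_add_not_nu_eq:
  assumes "a + b \<in> tangibles G"
  shows "\<nu> a \<noteq> \<nu> b"
  using assms add_nu_eq[of a b] nu_not_tangible[of a] by auto

text \<open>If \<open>y\<close> were strictly below \<open>a\<close>, then \<open>a + y = a\<close> and hence \<open>a t + y t = a t\<close> would be tangible,
  so that \<open>a t\<close> and \<open>y t\<close> could not be equal up to \<open>\<nu>\<close>. Thus multiplication by \<open>t\<close> keeps the
  inequality strict.\<close>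

lemma le_nu_cancel:
  assumes at: "a * t \<in> tangibles G" and le: "le_nu (a * t) (y * t)"
  shows "le_nu a y"
proof (rule ccontr)
  assume "\<not> le_nu a y"
  then have "a * t + y * t = a * t"
    using not_le_nu_add[of a y] by (simp add: distrib_right[symmetric])
  then have "\<nu> (a * t) \<noteq> \<nu> (y * t)" "\<nu> (a * t) + \<nu> (y * t) = \<nu> (a * t)"
    using tangible_add_not_nu_eq[of "a * t" "y * t"] at nu_add[of "a * t" "y * t"] by simp_all
  with le show False by (simp add: le_nu_def)
qed

text \<open>Two \<open>\<nu>\<close>-maximal terms would add up to a ghost.\<close>

lemma tangible_sum_unique_max:
  assumes "finite S" "sum f S \<in> tangibles G"
  obtains p where "p \<in> S" "f p = sum f S" "\<And>q. q \<in> S \<Longrightarrow> q \<noteq> p \<Longrightarrow> \<not> le_nu (f p) (f q)"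
proof -
  have "\<exists>p\<in>S. f p = sum f S \<and> (\<forall>q\<in>S. q \<noteq> p \<longrightarrow> \<not> le_nu (f p) (f q))"
    using assms
  proof (induction S rule: finite_induct)
    case empty
    then show ?case by (simp add: tangibles_def)
  next
    case (insert s S)
    have tan: "f s + sum f S \<in> tangibles G" using insert by simp
    from tangible_add_not_nu_eq[OF tan] have neq: "\<nu> (f s) \<noteq> \<nu> (sum f S)" .
    show ?case
    proof (cases "le_nu (f s) (sum f S)")
      case True
      then have lt: "\<not> le_nu (sum f S) (f s)"
        using neq unfolding le_nu_def by (metis add.commute)
      then have eq: "f s + sum f S = sum f S" using not_le_nu_add[OF lt] by (simp add: add.commute)
      with insert.IH tan obtain p where
        "p \<in> S" "f p = sum f S" "\<forall>q\<in>S. q \<noteq> p \<longrightarrow> \<not> le_nu (f p) (f q)" by auto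
      then show ?thesis using lt eq insert.hyps by (intro bexI[of _ p]) auto
    next
      case False
      then have "f s + sum f S = f s" by (rule not_le_nu_add)
      moreover have "\<not> le_nu (f s) (f q)" if "q \<in> S" for q
        using False le_nu_sum[OF insert.hyps(1) that] le_nu_trans by blast
      ultimately show ?thesis using insert.hyps by (intro bexI[of _ s]) auto
    qed
  qed
  then show ?thesis using that by blast
qed

text \<open>Without a rival, the term \<open>f p\<close> would be the whole sum. But a tangible element ghost surpasses
  only itself, so then \<open>f p = v\<close>, which \<open>\<not> le_nu (f p) v\<close> excludes.\<close>

lemma ghost_surpasses_sum_rival:
  assumes S: "finite S" "p \<in> S" and gs: "ghost_surpasses G (sum f S) v"
    and tan: "f p \<in> tangibles G" and lt: "\<not> le_nu (f p) v"
  obtains q where "q \<in> S" "q \<noteq> p" "le_nu (f p) (f q)"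
proof (rule ccontr)
  assume "\<not> thesis"
  then have "f p + sum f (S - {p}) = f p"
    using S that by (intro not_le_nu_sum) auto
  then have "sum f S = f p" using sum.remove[OF S, of f] by simp
  with gs obtain c where c: "c \<in> insert 0 G" "f p = v + c"
    unfolding ghost_surpasses_def by metis
  have "\<nu> v \<noteq> \<nu> c" using tan c by (intro tangible_add_not_nu_eq) simp
  then have "f p = v \<or> f p = c" using add_nu_neq[of v c] c by auto
  moreover have "f p \<noteq> v" using lt le_nu_refl[of v] by auto
  moreover have "f p \<noteq> c" using tan c by (auto simp: tangibles_def)
  ultimately show False by blast
qed

lemma nu_retract:
  assumes "tangible_retract G h"
  shows "\<nu> (h b) = \<nu> b"
proof (cases "b \<in> insert 0 (tangibles G)")
  case True
  then have "h b = b" using assms unfolding tangible_retract_def by blast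
  then show ?thesis by simp
next
  case False
  then have b: "b \<in> G" by (auto simp: tangibles_def)
  then obtain t where "b = \<nu> t" using nu_onto by auto
  then have "\<nu> b = b" by (simp add: nu_idem)
  then show ?thesis using assms b by (simp add: tangible_retract_def)
qed


section \<open>Weights of permutations\<close>

lemma tangible_permanent_unique_max:
  assumes A: "A \<in> carrier_mat n n" and tan: "permanent A \<in> tangibles G"
  obtains \<pi> where "\<pi> permutes {0..<n}" "(\<Prod>r = 0..<n. A $$ (r, \<pi> r)) = permanent A"
    "\<And>\<sigma>. \<sigma> permutes {0..<n} \<Longrightarrow> le_nu (permanent A) (\<Prod>r = 0..<n. A $$ (r, \<sigma> r)) \<Longrightarrow> \<sigma> = \<pi>"
proof -
  have perm: "permanent A = (\<Sum>p | p permutes {0..<n}. \<Prod>r = 0..<n. A $$ (r, p r))"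
    using A by (simp add: permanent_def)
  have fin: "finite {p. p permutes {0..<n}}" by (simp add: finite_permutations)
  obtain \<pi> where \<pi>: "\<pi> \<in> {p. p permutes {0..<n}}"
    and weight: "(\<Prod>r = 0..<n. A $$ (r, \<pi> r)) = permanent A"
    and max: "\<And>\<sigma>. \<sigma> \<in> {p. p permutes {0..<n}} \<Longrightarrow> \<sigma> \<noteq> \<pi> \<Longrightarrow>
      \<not> le_nu (\<Prod>r = 0..<n. A $$ (r, \<pi> r)) (\<Prod>r = 0..<n. A $$ (r, \<sigma> r))"
    using tangible_sum_unique_max[OF fin tan[unfolded perm]] unfolding perm by blast
  show ?thesis
  proof (rule that)
    show "\<pi> permutes {0..<n}" using \<pi> by simp
    show "(\<Prod>r = 0..<n. A $$ (r, \<pi> r)) = permanent A" by (rule weight)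
    fix \<sigma> assume "\<sigma> permutes {0..<n}" "le_nu (permanent A) (\<Prod>r = 0..<n. A $$ (r, \<sigma> r))"
    then show "\<sigma> = \<pi>" using max[of \<sigma>] weight by auto
  qed
qed

lemma partial_weight_le_nu_minor:
  fixes A :: "'a mat"
  assumes A: "A \<in> carrier_mat n n" and p: "p permutes {0..<n}" and k: "k < n"
  shows "le_nu (\<Prod>r \<in> {0..<n} - {k}. A $$ (r, p r)) (permanent (mat_delete A k (p k)))"
proof -
  obtain m where n: "n = Suc m" using k by (cases n) auto
  let ?q = "permutation_delete p k"
  let ?D = "mat_delete A k (p k)"
  have pk: "p k < Suc m" using permutes_in_image[OF p, of k] k n by simp
  have q: "?q permutes {0..<m}"
    using permutation_delete_permutes[of p m k] p k n by simp
  have entry: "A $$ (insert_index k r, p (insert_index k r)) = ?D $$ (r, ?q r)" if r: "r < m" for r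
  proof -
    have "?q r < m" using permutes_in_image[OF q, of r] r by simp
    moreover have "p (insert_index k r) \<noteq> p k"
      using permutes_inj[OF p] by (metis injD insert_index_exclude)
    then have "insert_index (p k) (?q r) = p (insert_index k r)"
      by (simp add: permutation_delete_def delete_ran_def delete_dom_def insert_delete_index)
    ultimately show ?thesis using A n r by (simp add: mat_delete_def insert_index_def)
  qed
  have "(\<Prod>r \<in> {0..<n} - {k}. A $$ (r, p r)) =
      (\<Prod>r \<in> insert_index k ` {0..<m}. A $$ (r, p r))"
    using insert_index_image[of k m] k n by simp
  also have "\<dots> = (\<Prod>r = 0..<m. ?D $$ (r, ?q r))"
    by (subst prod.reindex[OF insert_index_inj_on]) (simp add: entry)
  finally have eq: "(\<Prod>r \<in> {0..<n} - {k}. A $$ (r, p r)) = (\<Prod>r = 0..<m. ?D $$ (r, ?q r))" .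
  have "dim_row ?D = m" using A n by simp
  then have "permanent ?D = (\<Sum>p | p permutes {0..<m}. \<Prod>r = 0..<m. ?D $$ (r, p r))"
    by (simp add: permanent_def)
  then show ?thesis
    unfolding eq using q
      le_nu_sum[of "{p. p permutes {0..<m}}" ?q "\<lambda>p. \<Prod>r = 0..<m. ?D $$ (r, p r)"]
    by (simp add: finite_permutations)
qed

end

lemma self_map_permutes_subset:
  assumes "finite S" "S \<noteq> {}" "g ` S \<subseteq> S"
  obtains C where "C \<subseteq> S" "C \<noteq> {}" "bij_betw g C C"
proof -
  \<comment> \<open>A nonempty invariant set of least cardinality equals its own image.\<close>
  let ?inv = "\<lambda>C. C \<subseteq> S \<and> C \<noteq> {} \<and> g ` C \<subseteq> C"
  have "?inv S" using assms by simp
  from ex_has_least_nat[of ?inv, OF this, of card]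
  obtain C where C: "C \<subseteq> S" "C \<noteq> {}" "g ` C \<subseteq> C"
    and least: "\<And>D. ?inv D \<Longrightarrow> card C \<le> card D" by auto
  have fin: "finite C" using C assms finite_subset by blast
  have "card C \<le> card (g ` C)" using C by (intro least conjI) auto
  then have "g ` C = C" using C fin by (intro card_seteq) auto
  then show ?thesis
    using that[OF C(1,2)] fin by (simp add: bij_betw_def finite_surj_inj)
qed


section \<open>Cramer's rule as an upper bound\<close>

context supertropical_domain
begin

text \<open>In the proof, \<open>f r\<close> is the rival column of a row \<open>r\<close> that is not bounded, and \<open>\<sigma>\<close> agrees with
  \<open>\<pi> \<circ> g\<close> on \<open>C\<close>, where \<open>g\<close> is the self-map of the rows, and with \<open>\<pi>\<close> elsewhere. The cancellations
  are legitimate because every factor on the smaller side is tangible: the entries \<open>a\<^sub>r\<^sub>,\<^sub>\<pi>\<^sub>r\<close> as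
  divisors of \<open>|A|\<close>, and the \<open>x\<^sub>c\<close> of the rival columns because a rival term dominates a product that
  is not below \<open>v\<^sub>r\<close> and so cannot be 0.\<close>

lemma tangible_cramer_bound:
  assumes A: "A \<in> carrier_mat n n" and tan: "permanent A \<in> tangibles G"
    and v: "v \<in> carrier_vec n" and x: "x \<in> carrier_vec n"
    and x_tan: "\<And>j. j < n \<Longrightarrow> x $ j \<in> insert 0 (tangibles G)"
    and gs: "\<And>j. j < n \<Longrightarrow> ghost_surpasses G ((A *\<^sub>v x) $ j) (v $ j)"
    and i: "i < n"
  shows "le_nu (permanent A * x $ i) ((perm_adj A *\<^sub>v v) $ i)"
proof (cases "x $ i = 0")
  case True
  then show ?thesis by (simp add: zero_le_nu)
next
  case False
  then have xi: "x $ i \<in> tangibles G" using x_tan[OF i] by simp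
  obtain \<pi> where \<pi>: "\<pi> permutes {0..<n}"
    and weight: "(\<Prod>r = 0..<n. A $$ (r, \<pi> r)) = permanent A"
    and max: "\<And>\<sigma>. \<sigma> permutes {0..<n} \<Longrightarrow>
      le_nu (permanent A) (\<Prod>r = 0..<n. A $$ (r, \<sigma> r)) \<Longrightarrow> \<sigma> = \<pi>"
    using tangible_permanent_unique_max[OF A tan] by blast
  have \<pi>_less: "\<pi> r < n" if "r < n" for r
    using permutes_in_image[OF \<pi>, of r] that by simp
  have diag: "A $$ (r, \<pi> r) \<in> tangibles G" if "r < n" for r
    using tangible_prod_factor[of "{0..<n}" r "\<lambda>r. A $$ (r, \<pi> r)"] weight tan that by simp
  define bounded where "bounded r \<longleftrightarrow> le_nu (A $$ (r, \<pi> r) * x $ \<pi> r) (v $ r)" for r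
  have "\<exists>c<n. c \<noteq> \<pi> r \<and> le_nu (A $$ (r, \<pi> r) * x $ \<pi> r) (A $$ (r, c) * x $ c)"
    if r: "r < n" and nb: "\<not> bounded r" for r
  proof -
    have "x $ \<pi> r \<noteq> 0" using nb by (auto simp: bounded_def zero_le_nu)
    then have "x $ \<pi> r \<in> tangibles G" using x_tan[OF \<pi>_less[OF r]] by simp
    then have t: "A $$ (r, \<pi> r) * x $ \<pi> r \<in> tangibles G"
      by (rule tangible_mult[OF diag[OF r]])
    have "(A *\<^sub>v x) $ r = (\<Sum>c = 0..<n. A $$ (r, c) * x $ c)"
      using A x r by (simp add: scalar_prod_def)
    then have g: "ghost_surpasses G (\<Sum>c = 0..<n. A $$ (r, c) * x $ c) (v $ r)"
      using gs[OF r] by simp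
    obtain c where "c \<in> {0..<n}" "c \<noteq> \<pi> r"
      "le_nu (A $$ (r, \<pi> r) * x $ \<pi> r) (A $$ (r, c) * x $ c)"
      by (rule ghost_surpasses_sum_rival[OF _ _ g, of "\<pi> r"])
        (use t nb \<pi>_less[OF r] in \<open>auto simp: bounded_def\<close>)
    then show ?thesis by auto
  qed
  then obtain f where f: "\<And>r. r < n \<Longrightarrow> \<not> bounded r \<Longrightarrow> f r < n \<and> f r \<noteq> \<pi> r \<and>
      le_nu (A $$ (r, \<pi> r) * x $ \<pi> r) (A $$ (r, f r) * x $ f r)"
    by metis
  have xf: "x $ f r \<in> tangibles G" if "r < n" "\<not> bounded r" for r
  proof -
    have "x $ f r \<noteq> 0"
    proof
      assume "x $ f r = 0"
      then have "le_nu (A $$ (r, \<pi> r) * x $ \<pi> r) 0" using f[OF that] by simp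
      then have "bounded r" unfolding bounded_def using le_nu_trans zero_le_nu by blast
      with that show False by simp
    qed
    then show ?thesis using x_tan f[OF that] by blast
  qed
  define g where "g r = inv_into UNIV \<pi> (if bounded r then i else f r)" for r
  have \<pi>g: "\<pi> (g r) = (if bounded r then i else f r)" for r
    using permutes_inverses(1)[OF \<pi>] by (simp add: g_def)
  have "g r < n" if "r < n" for r
    using permutes_in_image[OF permutes_inv[OF \<pi>], of "if bounded r then i else f r"]
      f[OF that] i by (simp add: g_def split: if_splits)
  then have maps: "g ` {0..<n} \<subseteq> {0..<n}" by auto
  have "{0..<n} \<noteq> {}" using i by simp
  then obtain C where C: "C \<subseteq> {0..<n}" "C \<noteq> {}" and bij: "bij_betw g C C"
    using self_map_permutes_subset[OF finite_atLeastLessThan _ maps] by blast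
  have fin: "finite C" using C finite_subset by blast
  have less: "r < n" if "r \<in> C" for r using C that by auto
  define \<tau> where "\<tau> r = (if r \<in> C then g r else r)" for r
  have "bij_betw \<tau> C C" using bij by (rule bij_betw_cong[THEN iffD1, rotated]) (simp add: \<tau>_def)
  then have "\<tau> permutes C" by (rule bij_imp_permutes) (simp add: \<tau>_def)
  then have \<tau>: "\<tau> permutes {0..<n}" using C(1) by (rule permutes_subset)
  define \<sigma> where "\<sigma> = \<pi> \<circ> \<tau>"
  have \<sigma>: "\<sigma> permutes {0..<n}" unfolding \<sigma>_def using \<tau> \<pi> by (rule permutes_compose)
  have \<sigma>_in: "\<sigma> r = \<pi> (g r)" if "r \<in> C" for r using that by (simp add: \<sigma>_def \<tau>_def)
  have \<sigma>_f: "\<sigma> r = f r" if "r \<in> C" "\<not> bounded r" for r using that by (simp add: \<sigma>_in \<pi>g)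
  have \<sigma>_out: "\<sigma> r = \<pi> r" if "r \<notin> C" for r using that by (simp add: \<sigma>_def \<tau>_def)
  let ?rest = "\<Prod>r \<in> {0..<n} - C. A $$ (r, \<pi> r)"
  have rest: "?rest = (\<Prod>r \<in> {0..<n} - C. A $$ (r, \<sigma> r))"
    by (intro prod.cong) (auto simp: \<sigma>_out)
  have perm_split: "permanent A = (\<Prod>r\<in>C. A $$ (r, \<pi> r)) * ?rest"
    using prod.subset_diff[OF C(1), of "\<lambda>r. A $$ (r, \<pi> r)"] weight by (simp add: mult.commute)
  have diag_C: "(\<Prod>r\<in>C. A $$ (r, \<pi> r)) \<in> tangibles G"
    using diag less by (intro tangible_prod) auto
  \<comment> \<open>If every row of \<open>C\<close> had a rival, \<open>\<sigma>\<close> would have at least the weight of \<open>\<pi>\<close>.\<close>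
  have "\<exists>k\<in>C. bounded k"
  proof (rule ccontr)
    assume "\<not> (\<exists>k\<in>C. bounded k)"
    then have nb: "\<not> bounded r" if "r \<in> C" for r using that by blast
    let ?t = "\<Prod>r\<in>C. x $ \<sigma> r"
    have t: "?t \<in> tangibles G" using nb less xf by (intro tangible_prod) (simp add: \<sigma>_f)
    have "?t = (\<Prod>r\<in>C. x $ \<pi> (g r))" by (simp add: \<sigma>_in)
    also have "\<dots> = (\<Prod>r\<in>C. x $ \<pi> r)" using bij by (rule prod.reindex_bij_betw)
    finally have t_eq: "?t = (\<Prod>r\<in>C. x $ \<pi> r)" .
    have "le_nu (\<Prod>r\<in>C. A $$ (r, \<pi> r) * x $ \<pi> r) (\<Prod>r\<in>C. A $$ (r, \<sigma> r) * x $ \<sigma> r)"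
      using f less nb by (intro le_nu_prod) (simp add: \<sigma>_f)
    then have "le_nu ((\<Prod>r\<in>C. A $$ (r, \<pi> r)) * ?t) ((\<Prod>r\<in>C. A $$ (r, \<sigma> r)) * ?t)"
      by (simp add: prod.distrib t_eq)
    then have "le_nu (\<Prod>r\<in>C. A $$ (r, \<pi> r)) (\<Prod>r\<in>C. A $$ (r, \<sigma> r))"
      by (rule le_nu_cancel[rotated]) (rule tangible_mult[OF diag_C t])
    then have "le_nu (permanent A) ((\<Prod>r\<in>C. A $$ (r, \<sigma> r)) * ?rest)"
      unfolding perm_split by (intro le_nu_mult le_nu_refl)
    also have "(\<Prod>r\<in>C. A $$ (r, \<sigma> r)) * ?rest = (\<Prod>r = 0..<n. A $$ (r, \<sigma> r))"
      using prod.subset_diff[OF C(1), of "\<lambda>r. A $$ (r, \<sigma> r)"] rest by (simp add: mult.commute)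
    finally have "\<sigma> = \<pi>" by (rule max[OF \<sigma>])
    moreover obtain r where r: "r \<in> C" using C by blast
    ultimately have "f r = \<pi> r" using \<sigma>_f[OF r nb[OF r]] by simp
    then show False using f[OF less[OF r] nb[OF r]] by simp
  qed
  then obtain k where k: "k \<in> C" "bounded k" by blast
  \<comment> \<open>All bounded rows have the same image under \<open>g\<close>, which is injective on \<open>C\<close>.\<close>
  have nb: "\<not> bounded r" if r: "r \<in> C - {k}" for r
  proof
    assume "bounded r"
    then have "g r = g k" using k by (simp add: g_def)
    then have "r = k" using inj_onD[OF bij_betw_imp_inj_on[OF bij]] k r by blast
    then show False using r by simp
  qed
  have \<pi>gk: "\<pi> (g k) = i" using k by (simp add: \<pi>g)
  have gk: "g k \<in> C" using bij k by (auto simp: bij_betw_def)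
  have bij': "bij_betw g (C - {k}) (C - {g k})"
    using bij k(1) by (auto simp: bij_betw_def inj_on_def)
  \<comment> \<open>The columns of the rivals in \<open>C - {k}\<close> are those that \<open>\<pi>\<close> assigns to \<open>C\<close>, except \<open>i\<close>.\<close>
  let ?t = "\<Prod>r \<in> C - {k}. x $ \<sigma> r"
  have t: "?t \<in> tangibles G" using nb less xf by (intro tangible_prod) (simp add: \<sigma>_f)
  have "?t = (\<Prod>r \<in> C - {k}. x $ \<pi> (g r))" by (simp add: \<sigma>_in)
  also have "\<dots> = (\<Prod>r \<in> C - {g k}. x $ \<pi> r)" using bij' by (rule prod.reindex_bij_betw)
  finally have t_eq: "(\<Prod>r\<in>C. x $ \<pi> r) = x $ i * ?t"
    using prod.remove[OF fin gk, of "\<lambda>r. x $ \<pi> r"] \<pi>gk by simp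
  let ?w = "\<Prod>r \<in> C - {k}. A $$ (r, \<sigma> r)"
  have "le_nu (\<Prod>r \<in> C - {k}. A $$ (r, \<pi> r) * x $ \<pi> r)
      (\<Prod>r \<in> C - {k}. A $$ (r, \<sigma> r) * x $ \<sigma> r)"
    using f less nb by (intro le_nu_prod) (simp add: \<sigma>_f)
  with k have "le_nu ((A $$ (k, \<pi> k) * x $ \<pi> k) * (\<Prod>r \<in> C - {k}. A $$ (r, \<pi> r) * x $ \<pi> r))
      (v $ k * (\<Prod>r \<in> C - {k}. A $$ (r, \<sigma> r) * x $ \<sigma> r))"
    unfolding bounded_def by (intro le_nu_mult) auto
  also have "(A $$ (k, \<pi> k) * x $ \<pi> k) * (\<Prod>r \<in> C - {k}. A $$ (r, \<pi> r) * x $ \<pi> r) =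
      (\<Prod>r\<in>C. A $$ (r, \<pi> r) * x $ \<pi> r)"
    using prod.remove[OF fin k(1), of "\<lambda>r. A $$ (r, \<pi> r) * x $ \<pi> r"] by simp
  also have "\<dots> = (\<Prod>r\<in>C. A $$ (r, \<pi> r)) * x $ i * ?t"
    by (simp add: prod.distrib t_eq mult.assoc)
  also have "v $ k * (\<Prod>r \<in> C - {k}. A $$ (r, \<sigma> r) * x $ \<sigma> r) = v $ k * ?w * ?t"
    by (simp add: prod.distrib mult.assoc)
  finally have "le_nu ((\<Prod>r\<in>C. A $$ (r, \<pi> r)) * x $ i) (v $ k * ?w)"
    by (rule le_nu_cancel[rotated]) (intro tangible_mult diag_C xi t)
  then have "le_nu ((\<Prod>r\<in>C. A $$ (r, \<pi> r)) * x $ i * ?rest) (v $ k * ?w * ?rest)"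
    by (rule le_nu_mult[OF _ le_nu_refl])
  moreover have "?w * ?rest = (\<Prod>r \<in> {0..<n} - {k}. A $$ (r, \<sigma> r))"
  proof -
    have "{0..<n} - {k} - (C - {k}) = {0..<n} - C" using k by auto
    moreover have "C - {k} \<subseteq> {0..<n} - {k}" using C(1) by blast
    ultimately show ?thesis
      using prod.subset_diff[of "C - {k}" "{0..<n} - {k}" "\<lambda>r. A $$ (r, \<sigma> r)"] rest
      by (simp add: mult.commute)
  qed
  ultimately have "le_nu (permanent A * x $ i) (v $ k * (\<Prod>r \<in> {0..<n} - {k}. A $$ (r, \<sigma> r)))"
    by (simp add: perm_split mult.assoc mult.commute mult.left_commute)
  moreover have "\<sigma> k = i" using \<sigma>_in[OF k(1)] \<pi>gk by simp
  then have "le_nu (v $ k * (\<Prod>r \<in> {0..<n} - {k}. A $$ (r, \<sigma> r)))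
      (v $ k * permanent (mat_delete A k i))"
    using partial_weight_le_nu_minor[OF A \<sigma> less[OF k(1)]] by (intro le_nu_mult le_nu_refl) simp
  moreover have "le_nu (v $ k * permanent (mat_delete A k i)) ((perm_adj A *\<^sub>v v) $ i)"
  proof -
    have "(perm_adj A *\<^sub>v v) $ i = (\<Sum>j = 0..<n. v $ j * permanent (mat_delete A j i))"
      using A v i by (simp add: perm_adj_def scalar_prod_def mult.commute)
    then show ?thesis
      using le_nu_sum[of "{0..<n}" k "\<lambda>j. v $ j * permanent (mat_delete A j i)"] less[OF k(1)]
      by simp
  qed
  ultimately show ?thesis using le_nu_trans by blast
qed

end

lemma mult_inverse_right:
  assumes "(a::'a::comm_semiring_1) * b = 1"
  shows "a * mult_inverse a = 1"
  unfolding mult_inverse_def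
proof (rule theI)
  show "a * b = 1" by (rule assms)
  fix c assume "a * c = 1"
  then show "c = b" using assms by (metis mult.assoc mult.commute mult_1_right)
qed

theorem theorem3p8:
  fixes G :: "'a::comm_semiring_1 set"
    and h :: "'a \<Rightarrow> 'a"
    and A :: "'a mat" and v x :: "'a vec" and n :: nat
  assumes "supertropical_domain G"
    and "tangible_retract G h"
    and "A \<in> carrier_mat n n"
    and "quasi_invertible A"
    and "v \<in> carrier_vec n"
    and "x \<in> carrier_vec n"
    and "tangible_vec G x"
    and "ghost_surpasses_vec G (A *\<^sub>v x) v"
  shows "le_nu_vec x (map_vec h (quasi_inverse A *\<^sub>v v))"
proof -
  interpret supertropical_domain G by (rule assms(1))
  let ?d = "mult_inverse (permanent A)"
  have inv: "permanent A * ?d = 1"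
    using assms(4) mult_inverse_right by (auto simp: quasi_invertible_def)
  then have tan: "permanent A \<in> tangibles G"
    using tangible_factor(1)[of "permanent A" ?d] tangible_one by simp
  have dim: "dim_row (quasi_inverse A) = n"
    using assms(3) by (simp add: quasi_inverse_def perm_adj_def)
  have "le_nu (x $ i) (h ((quasi_inverse A *\<^sub>v v) $ i))" if i: "i < n" for i
  proof -
    have "le_nu (permanent A * x $ i) ((perm_adj A *\<^sub>v v) $ i)"
      using assms(3,5-8) i
      by (intro tangible_cramer_bound[OF _ tan])
        (auto simp: tangible_vec_def ghost_surpasses_vec_def)
    then have "le_nu (?d * (permanent A * x $ i)) (?d * (perm_adj A *\<^sub>v v) $ i)"
      by (intro le_nu_mult le_nu_refl)
    also have "?d * (permanent A * x $ i) = x $ i"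
      using inv by (metis mult.assoc mult.commute mult_1_left)
    also have "?d * (perm_adj A *\<^sub>v v) $ i = (quasi_inverse A *\<^sub>v v) $ i"
      using assms(3,5) i
      by (simp add: quasi_inverse_def perm_adj_def scalar_prod_def sum_distrib_left mult.assoc)
    finally show ?thesis by (simp add: le_nu_def nu_retract[OF assms(2)])
  qed
  then show ?thesis using assms(6) dim by (auto simp: le_nu_vec_def)
qed

end
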